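(* Let $G$ be a simple graph on $n$ vertices with at least one edge, where $n$ is even, and let $0=\mu_1\le\mu_2\le\cdots\le\mu_n$ be the eigenvalues of its Laplacian matrix. If $2\mu_2\ge\mu_n$, then $G$ is elementary.
   Context: The Laplacian matrix of $G$ is $L=D-A$ ($D$ diagonal degree matrix, $A$ adjacency matrix); $\mu_i$ is its $i$-th smallest eigenvalue. A graph is elementary if it contains a perfect matching and the edges that lie in at least one perfect matching of $G$ induce a connected subgraph. *)

theory Defs
  imports "HOL-Analysis.Analysis" "HOL-Computational_Algebra.Computational_Algebra"
begin

text \<open>
  The vertex set of a graph is the finite type \<open>'v\<close> (so the number of vertices is \<open>CARD('v)\<close>);
  a graph is given by its set of edges, each edge being a set of two vertices.
\<close>

definition simple_graph :: "'v::finite set set \<Rightarrow> bool" where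
  "simple_graph E \<longleftrightarrow> (\<forall>e\<in>E. card e = 2)"

definition vertex_degree :: "'v::finite set set \<Rightarrow> 'v \<Rightarrow> nat" where
  "vertex_degree E v = card {e \<in> E. v \<in> e}"

definition degree_matrix :: "'v::finite set set \<Rightarrow> real^'v^'v" where
  "degree_matrix E = (\<chi> u v. if u = v then real (vertex_degree E u) else 0)"

text \<open>The diagonal is zero for a simple graph, since \<open>{u, u}\<close> is a singleton and hence not an edge.\<close>

definition adjacency_matrix :: "'v::finite set set \<Rightarrow> real^'v^'v" where
  "adjacency_matrix E = (\<chi> u v. if {u, v} \<in> E then 1 else 0)"

definition laplacian :: "'v::finite set set \<Rightarrow> real^'v^'v" where
  "laplacian E = degree_matrix E - adjacency_matrix E"

definition char_poly :: "real^'n^'n \<Rightarrow> real poly" where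
  "char_poly A = det (\<chi> i j. (if i = j then [:0, 1:] else 0) - [:A $ i $ j:])"

text \<open>
  The real eigenvalues in increasing order, repeated according to algebraic multiplicity. For a
  symmetric matrix all complex eigenvalues are real, so that the list has length \<open>CARD('n)\<close>.
\<close>

definition eigenvalue_list :: "real^'n^'n \<Rightarrow> real list" where
  "eigenvalue_list A = sorted_list_of_multiset (proots (char_poly A))"

text \<open>The index \<open>i\<close> starts at 1.\<close>

definition laplacian_eigenvalue :: "'v::finite set set \<Rightarrow> nat \<Rightarrow> real" where
  "laplacian_eigenvalue E i = eigenvalue_list (laplacian E) ! (i - 1)"

definition perfect_matching :: "'v::finite set set \<Rightarrow> 'v set set \<Rightarrow> bool" where
  "perfect_matching E M \<longleftrightarrow> M \<subseteq> E \<and> pairwise disjnt M \<and> \<Union>M = UNIV"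

text \<open>
  The subgraph induced by a set \<open>F\<close> of edges has vertex set \<open>\<Union>F\<close> and edge set \<open>F\<close>; it is connected
  if any two of its vertices are joined by a walk along edges in \<open>F\<close>.
\<close>

definition edge_induced_connected :: "'v set set \<Rightarrow> bool" where
  "edge_induced_connected F \<longleftrightarrow>
     \<Union>F \<noteq> {} \<and> (\<forall>u\<in>\<Union>F. \<forall>v\<in>\<Union>F. (u, v) \<in> {(x, y). {x, y} \<in> F}\<^sup>*)"

definition elementary :: "'v::finite set set \<Rightarrow> bool" where
  "elementary E \<longleftrightarrow>
     (\<exists>M. perfect_matching E M) \<and>
     edge_induced_connected {e \<in> E. \<exists>M. perfect_matching E M \<and> e \<in> M}"

end

theory Submission
  imports Defs
begin

text \<open>
  If no edge joins \<open>X\<close> and \<open>Y\<close>, project the indicator vectors of \<open>X\<close> and \<open>Y\<close> to vectors \<open>u\<close>, \<open>w\<close>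
  orthogonal to the constants. The Laplacian quadratic form takes the same value at \<open>\<alpha>u + \<beta>w\<close> and
  \<open>\<alpha>u - \<beta>w\<close>, so by the Rayleigh bounds the squared norms of these vectors differ by a factor of at most
  \<open>\<mu>\<^sub>n / \<mu>\<^sub>2 \<le> 2\<close>, which amounts to \<open>9|X||Y| \<le> (n - |X|)(n - |Y|)\<close>. If \<open>G - S\<close> had more than
  \<open>max 1 |S|\<close> components, they could be divided into \<open>X\<close> and \<open>Y\<close> so evenly that this fails; so \<open>G\<close> is
  1-tough. A 1-tough graph of even order is elementary, by an analysis of the maximal barriers that
  also yields Tutte's theorem.
\<close>

unbundle no fps_syntax

section \<open>Eigenvalues of symmetric matrices\<close>

lemma symmetric_matrix_dot:
  fixes A :: "real^'n^'n"
  assumes "transpose A = A"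
  shows "x \<bullet> (A *v y) = (A *v x) \<bullet> y"
  by (metis assms dot_lmul_matrix vector_transpose_matrix)

text \<open>For small \<open>t\<close> of the sign of \<open>p\<close> the linear term would
  outweigh the quadratic one. This serves as the first-order condition at a maximum of a quadratic
  form, without derivatives.\<close>

lemma nonpos_quadratic_imp_linear_zero:
  fixes p q :: real
  assumes "\<And>t. 2 * t * p + t\<^sup>2 * q \<le> 0"
  shows "p = 0"
proof (rule ccontr)
  assume "p \<noteq> 0"
  define s where "s = 1 / (\<bar>q\<bar> + 1)"
  have s: "0 < s" "s * \<bar>q\<bar> < 1"
    by (auto simp: s_def field_simps)
  have "2 * (s * p) * p + (s * p)\<^sup>2 * q = (s * p\<^sup>2) * (2 + s * q)"
    by (simp add: power2_eq_square algebra_simps)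
  moreover have "- (s * \<bar>q\<bar>) \<le> s * q"
    using s(1) by (metis abs_le_iff abs_mult abs_of_pos minus_le_iff order_refl)
  ultimately have "2 * (s * p) * p + (s * p)\<^sup>2 * q > 0"
    using s \<open>p \<noteq> 0\<close> by (auto intro!: mult_pos_pos)
  with assms[of "s * p"] show False by simp
qed

text \<open>A maximiser \<open>v\<close> of the quadratic form on the unit sphere of
  \<open>V\<close> is an eigenvector: the residual \<open>w = A *v v - l *\<^sub>R v\<close> stays
  in \<open>V\<close>, is orthogonal to \<open>v\<close>, and vanishes by the first-order condition
  in its own direction.\<close>

lemma symmetric_eigenvector_in_subspace:
  fixes A :: "real^'n^'n"
  assumes sym: "transpose A = A" and V: "subspace V" "V \<noteq> {0}"
    and inv: "\<And>x. x \<in> V \<Longrightarrow> A *v x \<in> V"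
  obtains v where "v \<in> V" "norm v = 1" "A *v v = (v \<bullet> (A *v v)) *\<^sub>R v"
proof -
  define K where "K = sphere 0 1 \<inter> V"
  have "compact K"
    unfolding K_def using V closed_subspace by (intro compact_Int_closed) auto
  moreover have "K \<noteq> {}"
  proof -
    obtain w where "w \<in> V" "w \<noteq> 0" using V subspace_0 by blast
    then have "w /\<^sub>R norm w \<in> K" using V by (auto simp: K_def subspace_scale)
    then show ?thesis by blast
  qed
  moreover have "continuous_on K (\<lambda>x. x \<bullet> (A *v x))"
    by (intro continuous_intros)
  ultimately obtain v where v: "v \<in> K" and max: "\<And>x. x \<in> K \<Longrightarrow> x \<bullet> (A *v x) \<le> v \<bullet> (A *v v)"
    using continuous_attains_sup by metis
  define l where "l = v \<bullet> (A *v v)"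
  have vV: "v \<in> V" and vn: "norm v = 1" using v by (auto simp: K_def)
  have vv: "v \<bullet> v = 1" using vn by (simp add: norm_eq_1)
  have bound: "x \<bullet> (A *v x) \<le> l * (x \<bullet> x)" if "x \<in> V" for x
  proof (cases "x = 0")
    case False
    have "x /\<^sub>R norm x \<in> K" using that V False by (auto simp: K_def subspace_scale)
    from max[OF this] have "(x \<bullet> (A *v x)) / (norm x)\<^sup>2 \<le> l"
      by (simp add: l_def matrix_vector_mult_scaleR power2_eq_square divide_simps)
    then show ?thesis using False
      by (simp add: divide_simps power2_norm_eq_inner split: if_splits)
  qed auto
  define w where "w = A *v v - l *\<^sub>R v"
  have wV: "w \<in> V" using V vV inv by (simp add: w_def subspace_diff subspace_scale)
  have vw: "v \<bullet> w = 0" by (simp add: w_def inner_diff_right vv l_def)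
  \<comment> \<open>The homogeneous \<open>bound\<close> applies to \<open>v + t *\<^sub>R w\<close>
    without normalising it; the terms constant in \<open>t\<close> cancel.\<close>
  have "w \<bullet> (A *v v) = 0"
  proof (rule nonpos_quadratic_imp_linear_zero)
    fix t :: real
    have "(v + t *\<^sub>R w) \<bullet> (A *v (v + t *\<^sub>R w)) \<le> l * ((v + t *\<^sub>R w) \<bullet> (v + t *\<^sub>R w))"
      using V vV wV by (intro bound) (simp add: subspace_add subspace_scale)
    moreover have "v \<bullet> (A *v w) = w \<bullet> (A *v v)"
      by (metis sym symmetric_matrix_dot inner_commute)
    ultimately show "2 * t * (w \<bullet> (A *v v)) + t\<^sup>2 * (w \<bullet> (A *v w) - l * (w \<bullet> w)) \<le> 0"
      using vw
      by (simp add: l_def[symmetric] inner_add_left inner_add_right matrix_vector_right_distrib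
          matrix_vector_mult_scaleR vv inner_commute[of w v] power2_eq_square algebra_simps)
  qed
  then have "w \<bullet> w = 0"
    using vw by (simp add: w_def inner_diff_right inner_diff_left inner_commute algebra_simps)
  then have "A *v v = l *\<^sub>R v" by (simp add: w_def)
  with vV vn show ?thesis using that by (simp add: l_def)
qed

text \<open>Take a largest orthonormal set of eigenvectors containing \<open>u\<close>. Its
  orthogonal complement is invariant under \<open>A\<close>, so a nonzero complement would contain a
  further eigenvector. The vector \<open>u\<close> is prescribed so that a known kernel vector can
  be made part of the basis.\<close>

lemma symmetric_eigenbasis:
  fixes A :: "real^'n^'n"
  assumes sym: "transpose A = A" and u: "norm u = 1" "A *v u = (u \<bullet> (A *v u)) *\<^sub>R u"
  obtains B where "finite B" "card B = CARD('n)" "span B = UNIV" "pairwise orthogonal B" "u \<in> B"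
    "\<And>b. b \<in> B \<Longrightarrow> norm b = 1" "\<And>b. b \<in> B \<Longrightarrow> A *v b = (b \<bullet> (A *v b)) *\<^sub>R b"
proof -
  define good where "good B \<longleftrightarrow> pairwise orthogonal B \<and> u \<in> B \<and>
      (\<forall>b\<in>B. norm b = 1 \<and> A *v b = (b \<bullet> (A *v b)) *\<^sub>R b)" for B
  have ind: "independent B" if "good B" for B
    using that unfolding good_def
    by (metis norm_zero pairwise_orthogonal_independent zero_neq_one)
  have "good {u}" using u by (simp add: good_def)
  moreover have "\<forall>C. good C \<longrightarrow> card C < Suc CARD('n)"
    using ind independent_bound by (fastforce simp: less_Suc_eq_le)
  ultimately have "\<exists>B. good B \<and> (\<forall>C. good C \<longrightarrow> card C \<le> card B)"
    by (rule ex_has_greatest_nat)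
  then obtain B where B: "good B" and Bmax: "\<And>C. good C \<Longrightarrow> card C \<le> card B" by blast
  have fin: "finite B" using ind[OF B] independent_bound by blast
  define V where "V = {x. \<forall>b\<in>B. b \<bullet> x = 0}"
  have V: "subspace V"
    by (auto simp: V_def subspace_def inner_add_right)
  have inv: "A *v x \<in> V" if "x \<in> V" for x
  proof -
    have "b \<bullet> (A *v x) = 0" if "b \<in> B" for b
    proof -
      have "b \<bullet> (A *v x) = (A *v b) \<bullet> x" by (rule symmetric_matrix_dot[OF sym])
      also have "\<dots> = (b \<bullet> (A *v b)) * (b \<bullet> x)"
        using B that unfolding good_def by (metis inner_scaleR_left)
      finally show ?thesis using \<open>x \<in> V\<close> that by (simp add: V_def)
    qed
    then show ?thesis by (simp add: V_def)
  qed
  have "V = {0}"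
  proof (rule ccontr)
    assume "V \<noteq> {0}"
    then obtain v where v: "v \<in> V" "norm v = 1" "A *v v = (v \<bullet> (A *v v)) *\<^sub>R v"
      using symmetric_eigenvector_in_subspace[OF sym V _ inv] by blast
    have "v \<notin> B" using v by (auto simp: V_def norm_eq_1)
    have "good (insert v B)"
      using B v unfolding good_def V_def by (auto simp: pairwise_insert orthogonal_def inner_commute)
    from Bmax[OF this] show False using fin \<open>v \<notin> B\<close> by simp
  qed
  have span: "span B = UNIV"
  proof (rule ccontr)
    assume "span B \<noteq> UNIV"
    then obtain x where "x \<noteq> 0" "\<And>y. y \<in> span B \<Longrightarrow> orthogonal x y"
      using orthogonal_to_subspace_exists_gen[of B UNIV] by auto
    then have "x \<in> V" by (auto simp: V_def orthogonal_def inner_commute span_base)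
    with \<open>V = {0}\<close> \<open>x \<noteq> 0\<close> show False by simp
  qed
  have "card B = CARD('n)"
    using dim_span_eq_card_independent[OF ind[OF B]] span by simp
  with span fin B show ?thesis using that unfolding good_def by blast
qed

section \<open>The eigenvalue list and Rayleigh bounds\<close>

text \<open>The matrix \<open>P\<close> with the basis as its columns is orthogonal, and
  \<open>(mat x - A) ** P = P ** D\<close> with \<open>D\<close> diagonal. Determinants then give
  the value at every real \<open>x\<close>, and polynomials with equal values are equal.\<close>

lemma char_poly_eigenbasis:
  fixes A :: "real^'n^'n"
  assumes B: "finite B" "card B = CARD('n)" "pairwise orthogonal B"
    "\<And>b. b \<in> B \<Longrightarrow> norm b = 1" "\<And>b. b \<in> B \<Longrightarrow> A *v b = (b \<bullet> (A *v b)) *\<^sub>R b"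
  shows "char_poly A = (\<Prod>b\<in>B. [:- (b \<bullet> (A *v b)), 1:])"
proof -
  obtain \<beta> :: "'n \<Rightarrow> real^'n" where \<beta>: "bij_betw \<beta> UNIV B"
    using finite_same_card_bij[of "UNIV :: 'n set" B] B by auto
  then have \<beta>B: "\<beta> j \<in> B" for j by (auto simp: bij_betw_def)
  define l where "l j = \<beta> j \<bullet> (A *v \<beta> j)" for j
  define P :: "real^'n^'n" where "P = (\<chi> i j. \<beta> j $ i)"
  have col: "column j P = \<beta> j" for j by (simp add: P_def column_def vec_eq_iff)
  have "orthogonal_matrix P"
    unfolding orthogonal_matrix_orthonormal_columns col
  proof (intro conjI allI impI)
    show "norm (\<beta> i) = 1" for i using B(4) \<beta>B by blast
    show "orthogonal (\<beta> i) (\<beta> j)" if "i \<noteq> j" for i j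
    proof -
      have "\<beta> i \<noteq> \<beta> j" using \<beta> that by (auto simp: bij_betw_def inj_eq)
      then show ?thesis using B(3) \<beta>B by (auto simp: pairwise_def)
    qed
  qed
  then have detP: "det P \<noteq> 0" using det_orthogonal_matrix by fastforce
  have "poly (char_poly A) x = poly (\<Prod>b\<in>B. [:- (b \<bullet> (A *v b)), 1:]) x" for x
  proof -
    define D :: "real^'n^'n" where "D = (\<chi> i j. if i = j then x - l i else 0)"
    have "(mat x - A) ** P = P ** D"
    proof -
      have "((mat x - A) ** P) $ i $ j = (P ** D) $ i $ j" for i j
      proof -
        have "((mat x - A) ** P) $ i $ j = ((mat x - A) *v \<beta> j) $ i"
          by (simp add: matrix_matrix_mult_def matrix_vector_mult_def P_def)
        also have "(mat x - A) *v \<beta> j = x *\<^sub>R \<beta> j - l j *\<^sub>R \<beta> j"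
        proof -
          have "mat x *v \<beta> j = x *\<^sub>R \<beta> j"
            by (simp add: vec_eq_iff matrix_vector_mult_def mat_def if_distrib if_distribR cong: if_cong)
          then show ?thesis using B(5)[OF \<beta>B, of j] by (simp add: matrix_vector_mult_diff_rdistrib l_def)
        qed
        also have "\<dots> $ i = (P ** D) $ i $ j"
          by (simp add: matrix_matrix_mult_def P_def D_def if_distrib if_distribR sum.delta' algebra_simps cong: if_cong)
        finally show ?thesis .
      qed
      then show ?thesis by (simp add: vec_eq_iff)
    qed
    then have "det (mat x - A) * det P = det P * det D" by (metis det_mul)
    then have "det (mat x - A) = det D" using detP by simp
    also have "\<dots> = (\<Prod>i\<in>UNIV. x - l i)" by (subst det_diagonal) (auto simp: D_def)
    also have "\<dots> = (\<Prod>b\<in>B. x - b \<bullet> (A *v b))"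
      unfolding l_def by (rule prod.reindex_bij_betw[OF \<beta>])
    finally have "det (mat x - A) = (\<Prod>b\<in>B. x - b \<bullet> (A *v b))" .
    moreover have "poly (char_poly A) x = det (mat x - A)"
      by (auto simp: char_poly_def det_def poly_sum poly_prod mat_def of_int_poly intro!: sum.cong prod.cong)
    ultimately show ?thesis by (simp add: poly_prod algebra_simps)
  qed
  then show ?thesis using poly_eq_poly_eq_iff by blast
qed

lemma eigenvalue_list_eigenbasis:
  fixes A :: "real^'n^'n"
  assumes B: "finite B" "card B = CARD('n)" "pairwise orthogonal B"
    "\<And>b. b \<in> B \<Longrightarrow> norm b = 1" "\<And>b. b \<in> B \<Longrightarrow> A *v b = (b \<bullet> (A *v b)) *\<^sub>R b"
  shows "eigenvalue_list A = sorted_list_of_multiset (image_mset (\<lambda>b. b \<bullet> (A *v b)) (mset_set B))"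
proof -
  have "proots (\<Prod>b\<in>B. [:- (b \<bullet> (A *v b)), 1:]) = (\<Sum>b\<in>B. {#b \<bullet> (A *v b)#})"
    by (subst proots_prod) auto
  also have "\<dots> = image_mset (\<lambda>b. b \<bullet> (A *v b)) (mset_set B)"
    using B(1) by (induction B rule: finite_induct) auto
  moreover have "char_poly A = (\<Prod>b\<in>B. [:- (b \<bullet> (A *v b)), 1:])"
    by (rule char_poly_eigenbasis) (use B in auto)
  ultimately show ?thesis by (simp add: eigenvalue_list_def)
qed

lemma orthonormal_quadratic_form:
  fixes A :: "real^'n^'n"
  assumes B: "finite B" "span B = UNIV" "pairwise orthogonal B"
    "\<And>b. b \<in> B \<Longrightarrow> norm b = 1" "\<And>b. b \<in> B \<Longrightarrow> A *v b = (b \<bullet> (A *v b)) *\<^sub>R b"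
  shows "z \<bullet> (A *v z) = (\<Sum>b\<in>B. (b \<bullet> (A *v b)) * (z \<bullet> b)\<^sup>2)"
    and "z \<bullet> z = (\<Sum>b\<in>B. (z \<bullet> b)\<^sup>2)"
proof -
  have z: "(\<Sum>b\<in>B. (z \<bullet> b) *\<^sub>R b) = z"
    using B by (intro orthonormal_basis_expand) auto
  have "A *v z = (\<Sum>b\<in>B. (z \<bullet> b) *\<^sub>R (A *v b))"
    by (subst z[symmetric]) (simp add: linear_sum[OF matrix_vector_mul_linear] matrix_vector_mult_scaleR)
  also have "\<dots> = (\<Sum>b\<in>B. (z \<bullet> b) *\<^sub>R (b \<bullet> (A *v b)) *\<^sub>R b)"
    using B(5) by (intro sum.cong) auto
  finally show "z \<bullet> (A *v z) = (\<Sum>b\<in>B. (b \<bullet> (A *v b)) * (z \<bullet> b)\<^sup>2)"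
    by (simp add: inner_sum_right power2_eq_square algebra_simps)
  have "z \<bullet> z = z \<bullet> (\<Sum>b\<in>B. (z \<bullet> b) *\<^sub>R b)" using z by simp
  then show "z \<bullet> z = (\<Sum>b\<in>B. (z \<bullet> b)\<^sup>2)"
    by (simp add: inner_sum_right power2_eq_square)
qed

text \<open>Put the normalised \<open>k\<close> into an eigenbasis. Its eigenvalue 0 is least by
  semidefiniteness and so accounts for entry 0 of the sorted list, even if 0 is repeated. A vector
  orthogonal to \<open>k\<close> expands in the remaining basis vectors, whose eigenvalues are the
  entries from 1 on.\<close>

lemma rayleigh_bounds:
  fixes A :: "real^'n^'n"
  assumes sym: "transpose A = A" and psd: "\<And>x. 0 \<le> x \<bullet> (A *v x)"
    and k: "k \<noteq> 0" "A *v k = 0" and z: "z \<bullet> k = 0"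
  shows "eigenvalue_list A ! 1 * (z \<bullet> z) \<le> z \<bullet> (A *v z)"
    and "z \<bullet> (A *v z) \<le> eigenvalue_list A ! (CARD('n) - 1) * (z \<bullet> z)"
proof -
  define u where "u = k /\<^sub>R norm k"
  have u: "norm u = 1" "A *v u = 0" "z \<bullet> u = 0"
    using k z by (simp_all add: u_def matrix_vector_mult_scaleR)
  then have "A *v u = (u \<bullet> (A *v u)) *\<^sub>R u" by simp
  from symmetric_eigenbasis[OF sym u(1) this] obtain B where
    B: "finite B" "card B = CARD('n)" "span B = UNIV" "pairwise orthogonal B" "u \<in> B"
    "\<And>b. b \<in> B \<Longrightarrow> norm b = 1" "\<And>b. b \<in> B \<Longrightarrow> A *v b = (b \<bullet> (A *v b)) *\<^sub>R b"
    by metis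
  define l where "l b = b \<bullet> (A *v b)" for b
  define C where "C = B - {u}"
  define xs where "xs = sorted_list_of_multiset (image_mset l (mset_set C))"
  have C: "finite C" "u \<notin> C" "B = insert u C" using B by (auto simp: C_def)
  have setxs: "set xs = l ` C" using C by (simp add: xs_def)
  have list: "eigenvalue_list A = 0 # xs"
  proof -
    have "eigenvalue_list A = sorted_list_of_multiset (image_mset l (mset_set B))"
      unfolding l_def using B by (intro eigenvalue_list_eigenbasis) auto
    also have "\<dots> = insort 0 xs" using C u by (simp add: xs_def l_def)
    also have "\<dots> = 0 # xs" using setxs psd by (intro insort_is_Cons) (auto simp: l_def)
    finally show ?thesis .
  qed
  have sorted: "sorted (0 # xs)" using list by (metis eigenvalue_list_def sorted_sorted_list_of_multiset)
  have len: "length xs = CARD('n) - 1"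
    using B(2) C by (simp add: xs_def flip: size_mset)
  have lower: "eigenvalue_list A ! 1 \<le> l b" if "b \<in> C" for b
  proof -
    have "l b \<in> set xs" using that setxs by simp
    then show ?thesis using sorted list by (cases xs) auto
  qed
  have upper: "l b \<le> eigenvalue_list A ! (CARD('n) - 1)" if "b \<in> C" for b
  proof -
    have "l b \<in> set xs" using that setxs by simp
    then obtain i where i: "i < length xs" "l b = (0 # xs) ! Suc i" by (auto simp: in_set_conv_nth)
    then have "(0 # xs) ! Suc i \<le> (0 # xs) ! (CARD('n) - 1)"
      using len by (intro sorted_nth_mono[OF sorted]) auto
    then show ?thesis using i list by simp
  qed
  note form = orthonormal_quadratic_form[OF B(1,3,4,6,7), of z]
  have 1: "z \<bullet> (A *v z) = (\<Sum>b\<in>C. l b * (z \<bullet> b)\<^sup>2)" and 2: "z \<bullet> z = (\<Sum>b\<in>C. (z \<bullet> b)\<^sup>2)"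
    using form C u by (simp_all add: l_def)
  \<comment> \<open>In dimension 1 the set \<open>C\<close> is empty, and the out-of-range entry 1
    is multiplied by 0.\<close>
  show "eigenvalue_list A ! 1 * (z \<bullet> z) \<le> z \<bullet> (A *v z)"
    unfolding 1 2 sum_distrib_left by (intro sum_mono mult_right_mono lower) auto
  show "z \<bullet> (A *v z) \<le> eigenvalue_list A ! (CARD('n) - 1) * (z \<bullet> z)"
    unfolding 1 2 sum_distrib_left by (intro sum_mono mult_right_mono upper) auto
qed

section \<open>Toughness from the Laplacian spectrum\<close>

lemma vertex_degree_eq_card_neighbours:
  assumes "simple_graph E"
  shows "vertex_degree E v = card {u. {v, u} \<in> E}"
proof -
  have "{e \<in> E. v \<in> e} = (\<lambda>u. {v, u}) ` {u. {v, u} \<in> E}"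
  proof (intro set_eqI iffI)
    fix e assume e: "e \<in> {e \<in> E. v \<in> e}"
    then have "card e = 2" using assms by (simp add: simple_graph_def)
    then obtain a b where "e = {a, b}" by (auto simp: card_2_iff)
    with e have "e = {v, a} \<or> e = {v, b}" by auto
    then show "e \<in> (\<lambda>u. {v, u}) ` {u. {v, u} \<in> E}" using e by auto
  qed auto
  moreover have "inj_on (\<lambda>u. {v, u}) {u. {v, u} \<in> E}"
    by (auto simp: inj_on_def doubleton_eq_iff)
  ultimately show ?thesis by (simp add: vertex_degree_def card_image)
qed

lemma laplacian_mult_component:
  fixes x :: "real^'v::finite"
  assumes "simple_graph E"
  shows "(laplacian E *v x) $ v = (\<Sum>u\<in>UNIV. if {v, u} \<in> E then x $ v - x $ u else 0)"
proof -
  have "(laplacian E *v x) $ v =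
      (\<Sum>u\<in>UNIV. (if v = u then real (vertex_degree E v) * x $ v else 0) - (if {v, u} \<in> E then x $ u else 0))"
    by (auto simp: laplacian_def matrix_vector_mult_def degree_matrix_def adjacency_matrix_def
        left_diff_distrib intro!: sum.cong)
  also have "\<dots> = real (vertex_degree E v) * x $ v - (\<Sum>u\<in>UNIV. if {v, u} \<in> E then x $ u else 0)"
    by (simp add: sum_subtractf)
  also have "real (vertex_degree E v) = (\<Sum>u\<in>UNIV. if {v, u} \<in> E then 1 else 0)"
    using assms by (simp add: vertex_degree_eq_card_neighbours sum.If_cases)
  also have "\<dots> * x $ v - (\<Sum>u\<in>UNIV. if {v, u} \<in> E then x $ u else 0) =
      (\<Sum>u\<in>UNIV. (if {v, u} \<in> E then 1 else 0) * x $ v - (if {v, u} \<in> E then x $ u else 0))"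
    by (simp only: sum_distrib_right sum_subtractf)
  also have "\<dots> = (\<Sum>u\<in>UNIV. if {v, u} \<in> E then x $ v - x $ u else 0)"
    by (intro sum.cong) auto
  finally show ?thesis .
qed

lemma transpose_laplacian: "transpose (laplacian E) = laplacian E"
  by (auto simp: laplacian_def degree_matrix_def adjacency_matrix_def transpose_def vec_eq_iff insert_commute)

lemma laplacian_mult_one:
  assumes "simple_graph E"
  shows "laplacian E *v (\<chi> v. 1) = 0"
  by (simp add: vec_eq_iff laplacian_mult_component[OF assms] cong: if_cong)

text \<open>Symmetrising \<open>x $ v * (x $ v - x $ u)\<close> in \<open>u\<close> and
  \<open>v\<close> produces the square. The factor 2 is there because the double sum meets each edge
  in both orders.\<close>

lemma laplacian_quadratic_form:
  fixes x :: "real^'v::finite"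
  assumes "simple_graph E"
  shows "2 * (x \<bullet> (laplacian E *v x)) =
    (\<Sum>v\<in>UNIV. \<Sum>u\<in>UNIV. if {v, u} \<in> E then (x $ v - x $ u)\<^sup>2 else 0)"
proof -
  let ?f = "\<lambda>v u. if {v, u} \<in> E then x $ v * (x $ v - x $ u) else 0"
  have "x \<bullet> (laplacian E *v x) = (\<Sum>v\<in>UNIV. \<Sum>u\<in>UNIV. ?f v u)"
    by (auto simp: inner_vec_def laplacian_mult_component[OF assms] sum_distrib_left intro!: sum.cong)
  moreover have "(\<Sum>v\<in>UNIV. \<Sum>u\<in>UNIV. ?f v u) = (\<Sum>v\<in>UNIV. \<Sum>u\<in>UNIV. ?f u v)"
    by (rule sum.swap)
  ultimately have "2 * (x \<bullet> (laplacian E *v x)) = (\<Sum>v\<in>UNIV. \<Sum>u\<in>UNIV. ?f v u + ?f u v)"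
    by (simp add: sum.distrib)
  also have "\<dots> = (\<Sum>v\<in>UNIV. \<Sum>u\<in>UNIV. if {v, u} \<in> E then (x $ v - x $ u)\<^sup>2 else 0)"
    by (intro sum.cong) (auto simp: insert_commute power2_eq_square algebra_simps)
  finally show ?thesis .
qed

lemma laplacian_psd:
  assumes "simple_graph E"
  shows "0 \<le> x \<bullet> (laplacian E *v x)"
proof -
  have "0 \<le> 2 * (x \<bullet> (laplacian E *v x))"
    unfolding laplacian_quadratic_form[OF assms] by (intro sum_nonneg) auto
  then show ?thesis by simp
qed

lemma laplacian_rayleigh_bounds:
  fixes z :: "real^'v::finite"
  assumes "simple_graph E" and "z \<bullet> (\<chi> v. 1) = 0"
  shows "laplacian_eigenvalue E 2 * (z \<bullet> z) \<le> z \<bullet> (laplacian E *v z)"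
    and "z \<bullet> (laplacian E *v z) \<le> laplacian_eigenvalue E CARD('v) * (z \<bullet> z)"
proof -
  have "(\<chi> v. 1) \<noteq> (0 :: real^'v)" by (simp add: vec_eq_iff)
  note R = rayleigh_bounds[OF transpose_laplacian laplacian_psd this laplacian_mult_one]
  show "laplacian_eigenvalue E 2 * (z \<bullet> z) \<le> z \<bullet> (laplacian E *v z)"
    using R(1)[OF assms(1,1,2)] by (simp add: laplacian_eigenvalue_def)
  show "z \<bullet> (laplacian E *v z) \<le> laplacian_eigenvalue E CARD('v) * (z \<bullet> z)"
    using R(2)[OF assms(1,1,2)] by (simp add: laplacian_eigenvalue_def)
qed

text \<open>For an edge \<open>{a, b}\<close> the vector \<open>axis a 1 - axis b 1\<close> is
  orthogonal to the constants and has a positive form. With the spectral hypothesis this makes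
  \<open>\<mu>\<^sub>2\<close> positive, so that it can be cancelled.\<close>

lemma largest_laplacian_eigenvalue_pos:
  fixes E :: "'v::finite set set"
  assumes "simple_graph E" "E \<noteq> {}"
  shows "0 < laplacian_eigenvalue E CARD('v)"
proof -
  obtain e where "e \<in> E" using assms by blast
  then have "card e = 2" using assms by (simp add: simple_graph_def)
  then obtain a b where ab: "e = {a, b}" "a \<noteq> b" by (auto simp: card_2_iff)
  define z :: "real^'v" where "z = axis a 1 - axis b 1"
  have "z \<bullet> (\<chi> v. 1) = 0" by (simp add: z_def inner_diff_left inner_axis')
  note bound = laplacian_rayleigh_bounds(2)[OF assms(1) this]
  let ?t = "\<lambda>v u. if {v, u} \<in> E then (z $ v - z $ u)\<^sup>2 else 0"
  have "0 < ?t a b" using \<open>e \<in> E\<close> ab by (simp add: z_def axis_def)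
  also have "?t a b \<le> (\<Sum>u\<in>UNIV. ?t a u)" by (intro member_le_sum) auto
  also have "\<dots> \<le> (\<Sum>v\<in>UNIV. \<Sum>u\<in>UNIV. ?t v u)"
    by (rule member_le_sum) (auto intro!: sum_nonneg)
  finally have "0 < z \<bullet> (laplacian E *v z)"
    using laplacian_quadratic_form[OF assms(1), of z] by simp
  with bound have "0 < laplacian_eigenvalue E CARD('v) * (z \<bullet> z)" by linarith
  then show ?thesis by (meson inner_ge_zero linorder_not_le mult_nonpos_nonneg)
qed

text \<open>The projections \<open>u\<close> and \<open>w\<close> have inner product
  \<open>- p\<close> but no cross term in the Laplacian form, so \<open>z\<close> and
  \<open>z'\<close> have the same form and different norms. Comparing them by the Rayleigh bounds
  gives \<open>6 * \<alpha> * \<beta> * p \<le> \<alpha>\<^sup>2 * U + \<beta>\<^sup>2 *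
  W\<close>.\<close>

lemma laplacian_separation:
  fixes E :: "'v::finite set set"
  assumes E: "simple_graph E" "E \<noteq> {}"
    and ev: "2 * laplacian_eigenvalue E 2 \<ge> laplacian_eigenvalue E CARD('v)"
    and XY: "X \<inter> Y = {}" "\<And>x y. x \<in> X \<Longrightarrow> y \<in> Y \<Longrightarrow> {x, y} \<notin> E"
  shows "9 * real (card X) * real (card Y) \<le>
    (real CARD('v) - real (card X)) * (real CARD('v) - real (card Y))"
proof (cases "X = {} \<or> Y = {}")
  case True
  have "card X \<le> CARD('v)" "card Y \<le> CARD('v)" by (auto intro: card_mono)
  then have "0 \<le> (real CARD('v) - real (card X)) * (real CARD('v) - real (card Y))" by simp
  then show ?thesis using True by auto
next
  case False
  define n where "n = real CARD('v)"
  define x where "x = real (card X)"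
  define y where "y = real (card Y)"
  define k :: "real^'v" where "k = (\<chi> v. 1)"
  define a :: "real^'v" where "a = (\<chi> v. if v \<in> X then 1 else 0)"
  define b :: "real^'v" where "b = (\<chi> v. if v \<in> Y then 1 else 0)"
  let ?L = "laplacian E"
  have sym: "p \<bullet> (?L *v q) = q \<bullet> (?L *v p)" for p q
    by (metis symmetric_matrix_dot transpose_laplacian inner_commute)
  have Lk: "?L *v k = 0" unfolding k_def by (rule laplacian_mult_one[OF E(1)])
  have kL: "k \<bullet> (?L *v p) = 0" for p using sym[of k p] Lk by simp
  have ip: "k \<bullet> k = n" "a \<bullet> a = x" "b \<bullet> b = y" "a \<bullet> k = x" "b \<bullet> k = y" "k \<bullet> a = x" "k \<bullet> b = y"
    by (simp_all add: inner_vec_def k_def a_def b_def n_def x_def y_def sum.If_cases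
        if_distrib if_distribR cong: if_cong)
  have ab: "a \<bullet> b = 0"
    using XY(1) by (auto simp: inner_vec_def a_def b_def intro!: sum.neutral)
  \<comment> \<open>Disjointness removes the diagonal contributions, the absence of edges between
    \<open>X\<close> and \<open>Y\<close> the others.\<close>
  have aLb: "a \<bullet> (?L *v b) = 0"
    unfolding inner_vec_def laplacian_mult_component[OF E(1)]
    using XY by (intro sum.neutral ballI) (auto simp: a_def b_def disjoint_iff intro!: sum.neutral)
  have pos: "x > 0" "y > 0" using False by (auto simp: x_def y_def card_gt_0_iff)
  have "card (X \<union> Y) \<le> CARD('v)" by (rule card_mono) auto
  then have xy: "x + y \<le> n" using XY(1) by (simp add: card_Un_disjoint x_def y_def n_def)
  have n: "n > 0" using pos xy by linarith
  define u where "u = a - (x / n) *\<^sub>R k"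
  define w where "w = b - (y / n) *\<^sub>R k"
  define U where "U = u \<bullet> u"
  define W where "W = w \<bullet> w"
  define p where "p = x * y / n"
  have uk: "u \<bullet> k = 0" "w \<bullet> k = 0"
    using n by (simp_all add: u_def w_def inner_diff_left ip)
  have U: "U = x * (n - x) / n"
    using n by (simp add: U_def u_def inner_diff_left inner_diff_right ip field_simps)
  have W: "W = y * (n - y) / n"
    using n by (simp add: W_def w_def inner_diff_left inner_diff_right ip field_simps)
  have p: "u \<bullet> w = - p"
    using n by (simp add: p_def u_def w_def inner_diff_left inner_diff_right ip ab field_simps)
  have "?L *v w = ?L *v b" by (simp add: w_def matrix_vector_mult_diff_distrib matrix_vector_mult_scaleR Lk)
  then have uLw: "u \<bullet> (?L *v w) = 0" by (simp add: u_def inner_diff_left aLb kL)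
  have wLu: "w \<bullet> (?L *v u) = 0" using uLw sym by metis
  \<comment> \<open>For fixed \<open>\<beta>\<close>, the quadratic \<open>\<alpha>\<^sup>2 * U - 6
    * \<alpha> * \<beta> * p + \<beta>\<^sup>2 * W\<close> is least at
    \<open>\<alpha> = 3 * p * \<beta> / U\<close>. Taking \<open>\<beta> = U\<close> clears the
    denominator, and nonnegativity becomes \<open>9 * p\<^sup>2 \<le> U * W\<close>.\<close>
  define \<alpha> where "\<alpha> = 3 * p"
  define \<beta> where "\<beta> = U"
  define z where "z = \<alpha> *\<^sub>R u + \<beta> *\<^sub>R w"
  define z' where "z' = \<alpha> *\<^sub>R u - \<beta> *\<^sub>R w"
  have zk: "z \<bullet> (\<chi> v. 1) = 0" "z' \<bullet> (\<chi> v. 1) = 0"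
    using uk by (simp_all add: z_def z'_def inner_add_left inner_diff_left k_def)
  have same: "z \<bullet> (?L *v z) = z' \<bullet> (?L *v z')"
    by (simp add: z_def z'_def inner_add_left inner_diff_left inner_add_right inner_diff_right
        matrix_vector_right_distrib matrix_vector_mult_diff_distrib matrix_vector_mult_scaleR uLw wLu)
  have zz: "z \<bullet> z = \<alpha>\<^sup>2 * U + \<beta>\<^sup>2 * W - 2 * \<alpha> * \<beta> * p" "z' \<bullet> z' = \<alpha>\<^sup>2 * U + \<beta>\<^sup>2 * W + 2 * \<alpha> * \<beta> * p"
    by (simp_all add: z_def z'_def inner_add_left inner_diff_left inner_add_right inner_diff_right
        inner_commute[of w u] p U_def W_def power2_eq_square algebra_simps)
  have ev_pos: "laplacian_eigenvalue E 2 > 0"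
    using largest_laplacian_eigenvalue_pos[OF E] ev by linarith
  have "laplacian_eigenvalue E 2 * (z' \<bullet> z') \<le> z \<bullet> (?L *v z)"
    using laplacian_rayleigh_bounds(1)[OF E(1) zk(2)] same by simp
  also have "\<dots> \<le> laplacian_eigenvalue E CARD('v) * (z \<bullet> z)"
    by (rule laplacian_rayleigh_bounds(2)[OF E(1) zk(1)])
  also have "\<dots> \<le> 2 * laplacian_eigenvalue E 2 * (z \<bullet> z)"
    by (intro mult_right_mono ev) auto
  finally have "z' \<bullet> z' \<le> 2 * (z \<bullet> z)"
    using ev_pos by (metis mult.assoc mult.left_commute mult_le_cancel_left_pos)
  then have "6 * \<alpha> * \<beta> * p \<le> \<alpha>\<^sup>2 * U + \<beta>\<^sup>2 * W" unfolding zz by (simp add: algebra_simps)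
  then have "U * (9 * p\<^sup>2) \<le> U * (U * W)"
    by (simp add: \<alpha>_def \<beta>_def power2_eq_square algebra_simps)
  moreover have "U > 0" unfolding U using pos xy n by simp
  ultimately have "9 * p\<^sup>2 \<le> U * W" by simp
  \<comment> \<open>Substituting \<open>U\<close>, \<open>W\<close> and \<open>p\<close> leaves a
    common positive factor \<open>x * y / n\<^sup>2\<close>.\<close>
  then have "(9 * x * y) * (x * y) / n\<^sup>2 \<le> ((n - x) * (n - y)) * (x * y) / n\<^sup>2"
    by (simp add: U W p_def power2_eq_square algebra_simps)
  then have "9 * x * y \<le> (n - x) * (n - y)"
    using pos n by (simp add: divide_le_cancel)
  then show ?thesis by (simp add: x_def y_def n_def)
qed

section \<open>Balanced splits and toughness\<close>

text \<open>Greedy division: each further item goes to the lighter side, so the difference never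
  exceeds the bound on a single item.\<close>

lemma balanced_subset_sum:
  fixes f :: "'a \<Rightarrow> real"
  assumes "finite P" "\<And>c. c \<in> P \<Longrightarrow> 0 \<le> f c \<and> f c \<le> b" "0 \<le> b"
  obtains Q where "Q \<subseteq> P" "\<bar>sum f (P - Q) - sum f Q\<bar> \<le> b"
proof -
  have "\<exists>Q\<subseteq>P. \<bar>sum f (P - Q) - sum f Q\<bar> \<le> b"
    using assms
  proof (induction P rule: finite_induct)
    case (insert c P)
    then obtain Q where Q: "Q \<subseteq> P" "\<bar>sum f (P - Q) - sum f Q\<bar> \<le> b" by auto
    have fin: "finite Q" "c \<notin> Q" using Q insert finite_subset by auto
    have c: "0 \<le> f c" "f c \<le> b" using insert.prems(1)[of c] by auto
    show ?case
    proof (cases "sum f (P - Q) - sum f Q \<ge> 0")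
      case True
      have "insert c P - insert c Q = P - Q" using insert by auto
      then have "\<bar>sum f (insert c P - insert c Q) - sum f (insert c Q)\<bar> \<le> b"
        using Q(2) fin c True by simp
      then show ?thesis using Q(1) by (intro exI[of _ "insert c Q"]) auto
    next
      case False
      have "insert c P - Q = insert c (P - Q)" using fin by auto
      then have "\<bar>sum f (insert c P - Q) - sum f Q\<bar> \<le> b"
        using Q(2) c False insert.hyps by simp
      then show ?thesis using Q(1) by (intro exI[of _ Q]) auto
    qed
  qed auto
  then show ?thesis using that by blast
qed

text \<open>A detached set of \<open>G[U]\<close> is a union of connected components; the number of components of
  \<open>G[U]\<close> is the maximal size of a detached family.\<close>

definition detached :: "'v set set \<Rightarrow> 'v set \<Rightarrow> 'v set \<Rightarrow> bool" where
  "detached E U C \<longleftrightarrow> C \<subseteq> U \<and> (\<forall>x\<in>C. \<forall>y\<in>U - C. {x, y} \<notin> E)"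

definition detached_family :: "'v set set \<Rightarrow> 'v set \<Rightarrow> 'v set set \<Rightarrow> bool" where
  "detached_family E U P \<longleftrightarrow> pairwise disjnt P \<and> {} \<notin> P \<and> (\<forall>C\<in>P. detached E U C)"

lemma detached_rest:
  assumes "\<forall>C\<in>P. detached E U C"
  shows "detached E U (U - \<Union>P)"
  using assms unfolding detached_def by (auto simp: insert_commute) (metis DiffI insert_commute)

text \<open>Whatever a detached family leaves uncovered is itself detached. This extra member is
  what later makes the toughness inequality strict.\<close>

lemma detached_family_insert_rest:
  assumes "detached_family E U P" "U - \<Union>P \<noteq> {}"
  shows "detached_family E U (insert (U - \<Union>P) P)"
  using assms detached_rest[of P E U]
  by (auto simp: detached_family_def pairwise_insert disjnt_def)

text \<open>This is 1-toughness, stated for detached families in place of components. With more than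
  \<open>card S\<close> members, no single one is large, so the members can be split evenly enough
  to contradict \<open>laplacian_separation\<close>.\<close>

lemma laplacian_tough:
  fixes E :: "'v::finite set set"
  assumes E: "simple_graph E" "E \<noteq> {}"
    and ev: "2 * laplacian_eigenvalue E 2 \<ge> laplacian_eigenvalue E CARD('v)"
    and fam: "detached_family E (- S) P"
  shows "card P \<le> max 1 (card S)"
proof (rule ccontr)
  assume neg: "\<not> card P \<le> max 1 (card S)"
  note sep = laplacian_separation[OF E ev]
  obtain P' where P': "detached_family E (- S) P'" "\<Union>P' = - S" "card P \<le> card P'"
  proof (cases "- S - \<Union>P = {}")
    case True
    moreover have "\<Union>P \<subseteq> - S" using fam by (auto simp: detached_family_def detached_def)
    ultimately have "\<Union>P = - S" by blast
    then show ?thesis using that[OF fam] by simp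
  next
    case False
    have "\<Union>P \<subseteq> - S" using fam by (auto simp: detached_family_def detached_def)
    then have "\<Union>(insert (- S - \<Union>P) P) = - S" by auto
    moreover have "card P \<le> card (insert (- S - \<Union>P) P)" by (intro card_mono) auto
    ultimately show ?thesis by (rule that[OF detached_family_insert_rest[OF fam False]])
  qed
  have P: "pairwise disjnt P'" "{} \<notin> P'" "\<And>C. C \<in> P' \<Longrightarrow> detached E (- S) C"
    using P'(1) by (auto simp: detached_family_def)
  have card_Un: "card (\<Union>Q) = sum card Q" if "Q \<subseteq> P'" for Q
    using that P(1) by (intro card_Union_disjoint) (auto intro: pairwise_subset)
  define N where "N = card (- S)"
  have n: "CARD('v) = card S + N"
    using card_Un_disjoint[of S "- S"] by (simp add: N_def)
  have N: "N = sum card P'" using card_Un[of P'] P'(2) by (simp add: N_def)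
  \<comment> \<open>Besides \<open>C\<close> there are at least \<open>card S\<close> members, each
    with at least one vertex.\<close>
  have big: "card C + card S \<le> N" if "C \<in> P'" for C
  proof -
    have "card S \<le> card (P' - {C})" using neg P'(3) that by simp
    also have "\<dots> \<le> sum card (P' - {C})"
      using P(2) sum_mono[of "P' - {C}" "\<lambda>_. 1" card] by (force simp: Suc_le_eq card_gt_0_iff)
    finally show ?thesis using that by (simp add: N sum.remove)
  qed
  obtain C where C: "C \<in> P'" using neg P'(3) by fastforce
  then have "C \<noteq> {}" using P(2) by blast
  then have C1: "card C \<ge> 1" by (simp add: Suc_le_eq card_gt_0_iff)
  show False
  proof (cases "S = {}")
    case True
    \<comment> \<open>With \<open>S\<close> empty the balanced split would end in the vacuous
      \<open>0 \<le> 0\<close>. Here \<open>C\<close> and its complement already do: both are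
      nonempty, and the separation bound reads \<open>9ab \<le> ab\<close>.\<close>
    have "P' - {C} \<noteq> {}"
    proof
      assume "P' - {C} = {}"
      then have "card P' \<le> 1" using card_mono[of "{C}" P'] by auto
      then show False using neg P'(3) by simp
    qed
    then obtain D where "D \<in> P'" "D \<noteq> C" by blast
    then have "D \<subseteq> - C" "D \<noteq> {}" using P C by (auto simp: pairwise_def disjnt_def)
    then have "- C \<noteq> {}" by blast
    then have D1: "card (- C) \<ge> 1" by (simp add: Suc_le_eq card_gt_0_iff)
    have "9 * real (card C) * real (card (- C)) \<le>
        (real CARD('v) - real (card C)) * (real CARD('v) - real (card (- C)))"
      by (rule sep) (use P(3)[OF C] True in \<open>auto simp: detached_def\<close>)
    moreover have "CARD('v) = card C + card (- C)"
      using card_Un_disjoint[of C "- C"] by simp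
    ultimately have "real (card C) * real (card (- C)) \<le> 0" by simp
    then show False using C1 D1 by (auto simp: mult_le_0_iff)
  next
    case False
    then have s: "card S \<ge> 1" by (simp add: Suc_le_eq card_gt_0_iff)
    obtain Q where Q: "Q \<subseteq> P'"
      "\<bar>sum (\<lambda>C. real (card C)) (P' - Q) - sum (\<lambda>C. real (card C)) Q\<bar> \<le> real N - real (card S)"
      using balanced_subset_sum[of P' "\<lambda>C. real (card C)" "real N - real (card S)"] big C
      by (smt (verit) finite of_nat_0_le_iff of_nat_add of_nat_mono)
    define x where "x = real (card (\<Union>Q))"
    define y where "y = real (card (\<Union>(P' - Q)))"
    define s where "s = real (card S)"
    have x: "x = sum (\<lambda>C. real (card C)) Q" using card_Un[OF Q(1)] by (simp add: x_def)
    have y: "y = sum (\<lambda>C. real (card C)) (P' - Q)" using card_Un[of "P' - Q"] by (simp add: y_def)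
    have xy: "real N = x + y" using Q(1) by (simp add: N x y sum.subset_diff)
    have "9 * x * y \<le> (real CARD('v) - x) * (real CARD('v) - y)"
      unfolding x_def y_def
    proof (rule sep)
      show "\<Union>Q \<inter> \<Union>(P' - Q) = {}" using P(1) Q(1) by (fastforce simp: pairwise_def disjnt_def)
      fix v w assume v: "v \<in> \<Union>Q" and w: "w \<in> \<Union>(P' - Q)"
      then obtain D where D: "v \<in> D" "D \<in> Q" by blast
      then have "w \<notin> D" using \<open>\<Union>Q \<inter> \<Union>(P' - Q) = {}\<close> w by blast
      then show "{v, w} \<notin> E" using D w P(3)[of D] Q(1) P'(2) unfolding detached_def by blast
    qed
    then have 9: "9 * x * y \<le> (s + y) * (s + x)" by (simp add: n xy s_def)
    have "\<bar>y - x\<bar> \<le> x + y - s" using Q(2) unfolding x[symmetric] y[symmetric] xy s_def .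
    then have "(y - x)\<^sup>2 \<le> (x + y - s)\<^sup>2" by (simp add: abs_le_square_iff[symmetric])
    \<comment> \<open>As \<open>4xy = (x + y)\<^sup>2 - (y - x)\<^sup>2\<close>, the balance gives
      \<open>4xy \<ge> 2s(x + y) - s\<^sup>2\<close>, while the separation bound gives
      \<open>8xy \<le> s(x + y) + s\<^sup>2\<close>. Together they leave
      \<open>3s(x + y) \<le> 3s\<^sup>2\<close>.\<close>
    then have "s * (x + y) \<le> s * s" using 9 by (simp add: power2_eq_square algebra_simps)
    moreover have "s > 0" using s by (simp add: s_def)
    ultimately have "x + y \<le> s" by simp
    then show False using big[OF C] C1 xy by (simp add: s_def)
  qed
qed

section \<open>Theorems of Hall and Tutte\<close>

text \<open>The Halmos-Vaughan induction. If every proper nonempty subfamily has a surplus, any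
  choice for one \<open>C\<close> can be fixed and deleted; otherwise a tight subfamily
  \<open>Q\<close> and the rest, stripped of the neighbours of \<open>Q\<close>, are solved
  separately.\<close>

lemma hall_marriage:
  fixes N :: "'a \<Rightarrow> 'b set"
  assumes "finite P" "\<And>C. C \<in> P \<Longrightarrow> finite (N C)"
    and "\<And>Q. Q \<subseteq> P \<Longrightarrow> card Q \<le> card (\<Union>(N ` Q))"
  shows "\<exists>f. inj_on f P \<and> (\<forall>C\<in>P. f C \<in> N C)"
  using assms
proof (induction "card P" arbitrary: P N rule: less_induct)
  case less
  note finP = less.prems(1) and finN = less.prems(2) and hall = less.prems(3)
  have finU: "finite (\<Union>(N ` Q))" if "Q \<subseteq> P" for Q
    using that finP finN by (auto intro: finite_subset)
  show ?case
  proof (cases "P = {}")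
    case False
    then obtain C where C: "C \<in> P" by blast
    show ?thesis
    proof (cases "\<exists>Q. Q \<subset> P \<and> Q \<noteq> {} \<and> card (\<Union>(N ` Q)) \<le> card Q")
      case False
      have "N C \<noteq> {}" using hall[of "{C}"] C by auto
      then obtain n where n: "n \<in> N C" by blast
      have "\<exists>f. inj_on f (P - {C}) \<and> (\<forall>D\<in>P - {C}. f D \<in> N D - {n})"
      proof (rule less.hyps)
        show "card (P - {C}) < card P" using C finP by (intro psubset_card_mono) auto
        show "finite (P - {C})" "\<And>D. D \<in> P - {C} \<Longrightarrow> finite (N D - {n})" using finP finN by auto
        fix Q assume Q: "Q \<subseteq> P - {C}"
        show "card Q \<le> card (\<Union>D\<in>Q. N D - {n})"
        proof (cases "Q = {}")
          case nonempty: False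
          moreover have "Q \<subset> P" using Q C by blast
          ultimately have "card Q < card (\<Union>(N ` Q))" using False by (meson not_le)
          moreover have "(\<Union>D\<in>Q. N D - {n}) = \<Union>(N ` Q) - {n}" by auto
          moreover have "card (\<Union>(N ` Q)) - 1 \<le> card (\<Union>(N ` Q) - {n})"
            by (simp add: card_Diff_singleton_if)
          ultimately show ?thesis by simp
        qed simp
      qed
      then obtain f where f: "inj_on f (P - {C})" "\<And>D. D \<in> P - {C} \<Longrightarrow> f D \<in> N D - {n}" by blast
      have "inj_on (f(C := n)) (insert C (P - {C}))"
        using f by (force simp: inj_on_def)
      then have "inj_on (f(C := n)) P" using C by (simp add: insert_absorb)
      then show ?thesis using f n by (intro exI[of _ "f(C := n)"]) auto
    next
      case True
      then obtain Q where Q: "Q \<subset> P" "Q \<noteq> {}" "card (\<Union>(N ` Q)) \<le> card Q" by blast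
      have fin: "finite Q" "finite (P - Q)" using Q finP finite_subset by auto
      let ?T = "\<Union>(N ` Q)"
      have "\<exists>f. inj_on f Q \<and> (\<forall>D\<in>Q. f D \<in> N D)"
        using Q finP finN hall fin by (intro less.hyps) (auto intro: psubset_card_mono)
      moreover have "\<exists>g. inj_on g (P - Q) \<and> (\<forall>D\<in>P - Q. g D \<in> N D - ?T)"
      proof (rule less.hyps)
        show "card (P - Q) < card P" using Q finP by (intro psubset_card_mono) auto
        show "finite (P - Q)" "\<And>D. D \<in> P - Q \<Longrightarrow> finite (N D - ?T)" using fin finN by auto
        fix R assume R: "R \<subseteq> P - Q"
        \<comment> \<open>Hall's condition for \<open>R \<union> Q\<close>, less the at most
          \<open>card Q\<close> elements of \<open>?T\<close>, is the condition for
          \<open>R\<close>.\<close>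
        have "card R + card Q = card (R \<union> Q)"
          using R fin by (subst card_Un_disjoint) (auto intro: finite_subset)
        also have "\<dots> \<le> card (\<Union>(N ` (R \<union> Q)))" using R Q by (intro hall) auto
        also have "\<Union>(N ` (R \<union> Q)) = (\<Union>D\<in>R. N D - ?T) \<union> ?T" by auto
        also have "card \<dots> \<le> card (\<Union>D\<in>R. N D - ?T) + card ?T" by (rule card_Un_le)
        finally show "card R \<le> card (\<Union>D\<in>R. N D - ?T)" using Q by simp
      qed
      ultimately obtain f g where f: "inj_on f Q" "\<And>D. D \<in> Q \<Longrightarrow> f D \<in> N D"
        and g: "inj_on g (P - Q)" "\<And>D. D \<in> P - Q \<Longrightarrow> g D \<in> N D - ?T" by blast
      define h where "h D = (if D \<in> Q then f D else g D)" for D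
      have hQ: "h D = f D" "h D \<in> ?T" if "D \<in> Q" for D using f(2)[OF that] that by (auto simp: h_def)
      have hR: "h D = g D" "h D \<notin> ?T" if "D \<in> P - Q" for D
        using g(2)[OF that] that by (simp_all add: h_def)
      have "inj_on h P"
      proof (rule inj_onI)
        fix D D' assume D: "D \<in> P" "D' \<in> P" "h D = h D'"
        then have "D \<in> Q \<longleftrightarrow> D' \<in> Q" using hQ(2) hR(2) by (metis DiffI)
        then show "D = D'" using D f(1) g(1) hQ(1) hR(1) by (metis DiffI inj_onD)
      qed
      moreover have "h D \<in> N D" if "D \<in> P" for D
        using f(2)[of D] g(2)[of D] that by (simp add: h_def)
      ultimately show ?thesis by blast
    qed
  qed auto
qed

section \<open>Gluing matchings\<close>

text \<open>A perfect matching of the subgraph induced by \<open>W\<close>. The relative form is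
  what allows induction on \<open>W\<close> and gluing over disjoint sets.\<close>

definition matching_on :: "'v set set \<Rightarrow> 'v set \<Rightarrow> 'v set set \<Rightarrow> bool" where
  "matching_on E W M \<longleftrightarrow> M \<subseteq> E \<and> pairwise disjnt M \<and> \<Union>M = W"

lemma perfect_matching_iff: "perfect_matching E M \<longleftrightarrow> matching_on E UNIV M"
  by (simp add: perfect_matching_def matching_on_def)

lemma matching_on_UN:
  assumes "\<And>i. i \<in> I \<Longrightarrow> matching_on E (W i) (M i)"
    and "\<And>i j. i \<in> I \<Longrightarrow> j \<in> I \<Longrightarrow> i \<noteq> j \<Longrightarrow> W i \<inter> W j = {}"
  shows "matching_on E (\<Union>i\<in>I. W i) (\<Union>i\<in>I. M i)"
proof -
  have "disjnt e e'" if "e \<in> M i" "e' \<in> M j" "i \<in> I" "j \<in> I" "e \<noteq> e'" for e e' i j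
  proof (cases "i = j")
    case True
    then show ?thesis using that assms(1)[of i] by (auto simp: matching_on_def pairwise_def)
  next
    case False
    have "e \<subseteq> W i" "e' \<subseteq> W j" using that assms(1) by (auto simp: matching_on_def)
    then show ?thesis using assms(2)[of i j] that False by (auto simp: disjnt_def)
  qed
  then have "pairwise disjnt (\<Union>i\<in>I. M i)" unfolding pairwise_def by blast
  moreover have "(\<Union>i\<in>I. M i) \<subseteq> E" using assms(1) by (auto simp: matching_on_def)
  moreover have "\<Union>(\<Union>i\<in>I. M i) = (\<Union>i\<in>I. \<Union>(M i))" by blast
  moreover have "\<dots> = (\<Union>i\<in>I. W i)" using assms(1) by (simp add: matching_on_def)
  ultimately show ?thesis by (simp add: matching_on_def)
qed

lemma matching_on_Un:
  assumes "matching_on E V M" "matching_on E W N" "V \<inter> W = {}"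
  shows "matching_on E (V \<union> W) (M \<union> N)"
  using matching_on_UN[of "UNIV :: bool set" E "\<lambda>b. if b then V else W" "\<lambda>b. if b then M else N"] assms
  by (auto simp: UNIV_bool Un_commute Int_commute)

lemma matching_on_edge: "e \<in> E \<Longrightarrow> matching_on E e {e}"
  by (simp add: matching_on_def)

text \<open>Meant for a barrier \<open>S\<close> and its components \<open>P\<close>: each barrier
  vertex is matched into the component assigned to it, and the rest of that component is matched
  internally.\<close>

lemma matching_on_assemble:
  assumes disj: "pairwise disjnt P" "S \<inter> \<Union>P = {}" and f: "bij_betw f P S"
    and C: "\<And>C. C \<in> P \<Longrightarrow> \<exists>c M. c \<in> C \<and> {f C, c} \<in> E \<and> matching_on E (C - {c}) M"
  shows "\<exists>M. matching_on E (S \<union> \<Union>P) M"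
proof -
  have "\<exists>M. matching_on E (insert (f C) C) M" if CP: "C \<in> P" for C
  proof -
    obtain c M where cM: "c \<in> C" "{f C, c} \<in> E" "matching_on E (C - {c}) M" using C CP by blast
    have "f C \<in> S" using f CP by (auto simp: bij_betw_def)
    then have "f C \<notin> C" using disj CP by blast
    then have "matching_on E ({f C, c} \<union> (C - {c})) ({{f C, c}} \<union> M)"
      using cM by (intro matching_on_Un matching_on_edge) auto
    moreover have "{f C, c} \<union> (C - {c}) = insert (f C) C" using cM by auto
    ultimately show ?thesis by metis
  qed
  then obtain M where M: "\<And>C. C \<in> P \<Longrightarrow> matching_on E (insert (f C) C) (M C)" by metis
  have "matching_on E (\<Union>C\<in>P. insert (f C) C) (\<Union>C\<in>P. M C)"
  proof (rule matching_on_UN[OF M])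
    fix C D assume CD: "C \<in> P" "D \<in> P" "C \<noteq> D"
    then have "f C \<noteq> f D" "f C \<in> S" "f D \<in> S" using f by (auto simp: bij_betw_def inj_on_def)
    moreover have "C \<inter> D = {}" using disj CD by (auto simp: pairwise_def disjnt_def)
    ultimately show "insert (f C) C \<inter> insert (f D) D = {}" using disj(2) CD by blast
  qed
  moreover have "(\<Union>C\<in>P. insert (f C) C) = S \<union> \<Union>P" using f by (auto simp: bij_betw_def)
  ultimately show ?thesis by metis
qed

text \<open>No edge of \<open>M\<close> crosses the cut \<open>A\<close>, so the edges inside
  \<open>A\<close> divide \<open>W \<inter> A\<close> into pairs.\<close>

lemma even_card_matched_Int:
  assumes "simple_graph E" "matching_on E W M"
    and "\<And>x y. {x, y} \<in> M \<Longrightarrow> x \<in> A \<longleftrightarrow> y \<in> A"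
  shows "even (card (W \<inter> A))"
proof -
  have pair2: "card e = 2" if "e \<in> M" for e
    using that assms(1,2) by (auto simp: simple_graph_def matching_on_def)
  then have pair: "\<exists>x y. e = {x, y}" if "e \<in> M" for e
    using that by (meson card_2_iff)
  have "W \<inter> A = \<Union>{e \<in> M. e \<subseteq> A}"
  proof (intro set_eqI iffI)
    fix x assume x: "x \<in> W \<inter> A"
    then obtain e where e: "e \<in> M" "x \<in> e" using assms(2) by (auto simp: matching_on_def)
    then obtain y where "e = {x, y}" using pair[of e] by (auto simp: insert_commute)
    then have "e \<subseteq> A" using assms(3)[of x y] e x by auto
    with e show "x \<in> \<Union>{e \<in> M. e \<subseteq> A}" by blast
  qed (use assms(2) in \<open>auto simp: matching_on_def\<close>)
  also have "card \<dots> = sum card {e \<in> M. e \<subseteq> A}"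
    using assms(2) by (intro card_Union_disjoint) (auto simp: matching_on_def pairwise_def)
  finally show ?thesis using pair2 by (simp add: dvd_sum)
qed

lemma detached_mono:
  assumes "detached E U C" "C \<subseteq> U'" "U' \<subseteq> U"
  shows "detached E U' C"
  using assms unfolding detached_def by blast

section \<open>Odd families and maximal barriers\<close>

text \<open>The members may be disconnected, but each contains an odd component of
  \<open>G[W - S]\<close>. Bounding all such families is therefore the same as bounding the number
  of odd components.\<close>

definition odd_family :: "'v set set \<Rightarrow> 'v set \<Rightarrow> 'v set \<Rightarrow> 'v set set \<Rightarrow> bool" where
  "odd_family E W S P \<longleftrightarrow> S \<subseteq> W \<and> detached_family E (W - S) P \<and> (\<forall>C\<in>P. odd (card C))"

definition tutte_condition :: "'v set set \<Rightarrow> 'v set \<Rightarrow> bool" where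
  "tutte_condition E W \<longleftrightarrow> (\<forall>S P. odd_family E W S P \<longrightarrow> card P \<le> card S)"

lemma tutte_condition_even:
  assumes "tutte_condition E W"
  shows "even (card W)"
proof (rule ccontr)
  assume "odd (card W)"
  then have "odd_family E W {} {W}"
    by (auto simp: odd_family_def detached_family_def detached_def)
  with assms have "card {W} \<le> card ({} :: 'a set)" unfolding tutte_condition_def by blast
  then show False by simp
qed

lemma odd_family_parity:
  fixes W :: "'v::finite set"
  assumes "odd_family E W S P"
  shows "even (card W) \<longleftrightarrow> even (card S + card P + card (W - S - \<Union>P))"
proof -
  have P: "pairwise disjnt P" "\<Union>P \<subseteq> W - S" "\<And>C. C \<in> P \<Longrightarrow> odd (card C)" "S \<subseteq> W"
    using assms by (auto simp: odd_family_def detached_family_def detached_def)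
  have "even (sum card Q) \<longleftrightarrow> even (card Q)" if "\<And>C. C \<in> Q \<Longrightarrow> odd (card C)" for Q :: "'v set set"
    using finite[of Q] that by (induction Q rule: finite_induct) auto
  then have "even (card (\<Union>P)) \<longleftrightarrow> even (card P)"
    using P by (simp add: card_Union_disjoint)
  moreover have "card (S \<union> \<Union>P \<union> (W - S - \<Union>P)) = card S + card (\<Union>P) + card (W - S - \<Union>P)"
    using P by (subst card_Un_disjoint | force)+
  moreover have "S \<union> \<Union>P \<union> (W - S - \<Union>P) = W" using P by blast
  ultimately show ?thesis by simp
qed

text \<open>Parity turns an excess of one into an excess of two: the leftover is then odd.\<close>

lemma odd_family_excess:
  fixes W :: "'v::finite set"
  assumes fam: "odd_family E W S P" and "even (card W)" "card S < card P"
  obtains Q where "odd_family E W S Q" "card S + 2 \<le> card Q"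
proof (cases "even (card (W - S - \<Union>P))")
  case True
  then have "even (card S + card P)" using odd_family_parity[OF fam] assms(2) by simp
  then have "card P \<noteq> Suc (card S)" by auto
  then show ?thesis using that[OF fam] assms(3) by simp
next
  case False
  let ?R = "W - S - \<Union>P"
  have ne: "?R \<noteq> {}" using False by (metis card.empty even_zero)
  have "odd_family E W S (insert ?R P)"
    using fam False detached_family_insert_rest[OF _ ne] by (simp add: odd_family_def)
  moreover have "?R \<notin> P" using ne by blast
  ultimately show ?thesis using that[of "insert ?R P"] assms(3) by simp
qed

text \<open>Here \<open>S\<close> is a barrier: the family \<open>P\<close> has as many members as
  \<open>S\<close> has vertices. By parity the leftover is even; if it is nonempty, moving one of
  its vertices into \<open>S\<close> leaves an odd set, which joins \<open>P\<close> and yields a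
  larger barrier.\<close>

lemma maximal_barrier_cover:
  fixes W :: "'v::finite set"
  assumes even: "even (card W)" and fam: "odd_family E W S P" "card P = card S"
    and max: "\<And>S' P'. odd_family E W S' P' \<Longrightarrow> S \<subseteq> S' \<Longrightarrow> card P' = card S' \<Longrightarrow> card S' \<le> card S"
  shows "S \<union> \<Union>P = W"
proof (rule ccontr)
  let ?R = "W - S - \<Union>P"
  have sub: "S \<subseteq> W" "\<Union>P \<subseteq> W - S" using fam by (auto simp: odd_family_def detached_family_def detached_def)
  assume "S \<union> \<Union>P \<noteq> W"
  then obtain v where v: "v \<in> ?R" using sub by blast
  have "even (card ?R)" using odd_family_parity[OF fam(1)] even fam(2) by simp
  then have odd: "odd (card (?R - {v}))" using card_Suc_Diff1[OF _ v] by (metis even_Suc finite)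
  then have ne: "?R - {v} \<noteq> {}" by (metis card.empty even_zero)
  have rest: "W - insert v S - \<Union>P = ?R - {v}" by auto
  have "detached_family E (W - insert v S) P"
    using fam(1) v unfolding odd_family_def detached_family_def detached_def by blast
  then have "detached_family E (W - insert v S) (insert (?R - {v}) P)"
    using detached_family_insert_rest[of E "W - insert v S" P] ne rest by simp
  then have "odd_family E W (insert v S) (insert (?R - {v}) P)"
    using fam(1) odd v by (auto simp: odd_family_def)
  moreover have "?R - {v} \<notin> P" using ne by blast
  moreover have "v \<notin> S" using v by blast
  ultimately show False using max[of "insert v S" "insert (?R - {v}) P"] fam(2) by auto
qed

text \<open>A violation in \<open>C - {c}\<close> has an excess of at least two by parity. Adding
  \<open>c\<close> and \<open>S1\<close> to \<open>S\<close>, and replacing \<open>C\<close> by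
  \<open>P1\<close>, gives at least \<open>card S - 1 + card S1 + 2\<close> members for
  \<open>card S + 1 + card S1\<close> vertices, hence a larger barrier.\<close>

lemma maximal_barrier_factor_critical:
  fixes W :: "'v::finite set"
  assumes tutte: "tutte_condition E W" and fam: "odd_family E W S P" "card P = card S"
    and max: "\<And>S' P'. odd_family E W S' P' \<Longrightarrow> S \<subseteq> S' \<Longrightarrow> card P' = card S' \<Longrightarrow> card S' \<le> card S"
    and C: "C \<in> P" "c \<in> C"
  shows "tutte_condition E (C - {c})"
proof (rule ccontr)
  assume "\<not> tutte_condition E (C - {c})"
  then obtain S1 P0 where "odd_family E (C - {c}) S1 P0" "card S1 < card P0"
    by (auto simp: tutte_condition_def not_le)
  moreover have "odd (card C)" using fam C by (simp add: odd_family_def)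
  then have "even (card (C - {c}))" using C by (simp add: card_Diff_singleton)
  ultimately obtain P1 where P1: "odd_family E (C - {c}) S1 P1" "card S1 + 2 \<le> card P1"
    using odd_family_excess by blast
  have P: "pairwise disjnt P" "{} \<notin> P" "\<And>D. D \<in> P \<Longrightarrow> detached E (W - S) D"
    "\<And>D. D \<in> P \<Longrightarrow> odd (card D)" "S \<subseteq> W"
    using fam by (auto simp: odd_family_def detached_family_def)
  have Q: "pairwise disjnt P1" "{} \<notin> P1" "\<And>D. D \<in> P1 \<Longrightarrow> detached E (C - {c} - S1) D"
    "\<And>D. D \<in> P1 \<Longrightarrow> odd (card D)" "S1 \<subseteq> C - {c}"
    using P1 by (auto simp: odd_family_def detached_family_def)
  define S' where "S' = S \<union> insert c S1"
  define P' where "P' = (P - {C}) \<union> P1"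
  have CW: "C \<subseteq> W - S" using P(3)[OF C(1)] by (simp add: detached_def)
  have disj: "D \<inter> C = {}" if "D \<in> P - {C}" for D
    using P(1) C that by (auto simp: pairwise_def disjnt_def)
  have subC: "D \<subseteq> C - {c} - S1" if "D \<in> P1" for D using Q(3)[OF that] by (simp add: detached_def)
  have "detached E (W - S') D" if "D \<in> P'" for D
  proof (cases "D \<in> P1")
    case True
    then show ?thesis
      using Q(3)[OF True] P(3)[OF C(1)] subC[OF True] CW unfolding detached_def S'_def by blast
  next
    case False
    then have D: "D \<in> P - {C}" using that by (simp add: P'_def)
    then have det: "detached E (W - S) D" using P(3) by blast
    have "D \<inter> insert c S1 = {}" using disj[OF D] Q(5) C(2) by blast
    then have "D \<subseteq> W - S'" using det unfolding detached_def S'_def by blast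
    with det show ?thesis by (rule detached_mono) (auto simp: S'_def)
  qed
  moreover have "disjnt D D'" if "D \<in> P - {C}" "D' \<in> P1" for D D'
    using disj[OF that(1)] subC[OF that(2)] by (auto simp: disjnt_def)
  then have "pairwise disjnt P'"
    using P(1) Q(1) unfolding pairwise_def P'_def by (metis DiffD1 UnE disjnt_sym)
  moreover have "S' \<subseteq> W" using P(5) Q(5) CW C by (auto simp: S'_def)
  ultimately have fam': "odd_family E W S' P'"
    using P(2,4) Q(2,4) by (auto simp: odd_family_def detached_family_def P'_def)
  have "card (insert c S1) = Suc (card S1)" using Q(5) by (subst card_insert_disjoint) auto
  moreover have "S \<inter> insert c S1 = {}" using CW C(2) Q(5) by blast
  ultimately have cS: "card S' = card S + Suc (card S1)"
    unfolding S'_def by (metis card_Un_disjoint finite)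
  have "(P - {C}) \<inter> P1 = {}"
  proof (rule ccontr)
    assume "(P - {C}) \<inter> P1 \<noteq> {}"
    then obtain D where D: "D \<in> P - {C}" "D \<in> P1" by blast
    then have "D = {}" using disj[OF D(1)] subC[OF D(2)] by blast
    with D(2) Q(2) show False by simp
  qed
  then have "card P' = card P - 1 + card P1"
    using C(1) by (simp add: P'_def card_Un_disjoint card_Diff_singleton)
  moreover have "card P > 0" using C by (auto simp: card_gt_0_iff)
  moreover have "card P' \<le> card S'" using tutte fam' by (simp add: tutte_condition_def)
  ultimately have "card P' = card S'" using cS P1(2) fam(2) by simp
  moreover have "S \<subseteq> S'" by (auto simp: S'_def)
  ultimately have "card S' \<le> card S" using max fam' by blast
  with cS show False by simp
qed

text \<open>The maximal barrier is grown from a given one, because the cut argument needs it to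
  contain both ends of a chosen edge.\<close>

lemma maximal_barrier_exists:
  fixes W :: "'v::finite set"
  assumes "odd_family E W S P" "card P = card S"
  obtains S' P' where "S \<subseteq> S'" "odd_family E W S' P'" "card P' = card S'"
    "\<And>S'' P''. odd_family E W S'' P'' \<Longrightarrow> S' \<subseteq> S'' \<Longrightarrow> card P'' = card S'' \<Longrightarrow> card S'' \<le> card S'"
proof -
  define good where "good T \<longleftrightarrow> S \<subseteq> T \<and> (\<exists>Q. odd_family E W T Q \<and> card Q = card T)" for T
  have "good S" using assms by (auto simp: good_def)
  moreover have "\<forall>T. good T \<longrightarrow> card T < Suc CARD('v)" 
    by (metis card_mono finite less_Suc_eq_le subset_UNIV)
  ultimately have "\<exists>T. good T \<and> (\<forall>T'. good T' \<longrightarrow> card T' \<le> card T)" by (rule ex_has_greatest_nat)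
  then obtain T where T: "good T" "\<And>T'. good T' \<Longrightarrow> card T' \<le> card T" by blast
  then obtain Q where "S \<subseteq> T" "odd_family E W T Q" "card Q = card T" by (auto simp: good_def)
  moreover have "card T' \<le> card T" if "odd_family E W T' Q'" "T \<subseteq> T'" "card Q' = card T'" for T' Q'
    using T that \<open>S \<subseteq> T\<close> by (auto simp: good_def)
  ultimately show ?thesis using that by metis
qed

text \<open>Vertices of \<open>S\<close> without a neighbour in the members of \<open>Q\<close> can
  be put back without attaching to them. Thus Tutte's condition at the neighbourhood of
  \<open>Q\<close> is Hall's condition for assigning components to barrier vertices.\<close>

lemma odd_family_neighbours:
  assumes fam: "odd_family E W S P" and "Q \<subseteq> P"
  shows "odd_family E W (\<Union>C\<in>Q. {s \<in> S. \<exists>c\<in>C. {s, c} \<in> E}) Q" (is "odd_family E W ?T Q")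
proof -
  have "detached E (W - ?T) C" if "C \<in> Q" for C
  proof -
    have C: "detached E (W - S) C" 
      using fam assms(2) that unfolding odd_family_def detached_family_def by blast
    have "{x, y} \<notin> E" if xy: "x \<in> C" "y \<in> W - ?T - C" for x y
    proof (cases "y \<in> S")
      case True
      then show ?thesis using xy \<open>C \<in> Q\<close> by (auto simp: insert_commute)
    next
      case False
      then show ?thesis using xy C by (auto simp: detached_def)
    qed
    moreover have "C \<subseteq> W - ?T" using C by (auto simp: detached_def)
    ultimately show ?thesis by (simp add: detached_def)
  qed
  moreover have "?T \<subseteq> W" using fam by (auto simp: odd_family_def)
  ultimately show ?thesis
    using fam assms(2) by (auto simp: odd_family_def detached_family_def intro: pairwise_subset)
qed

text \<open>A maximal barrier and its odd components cover \<open>W\<close>. Hall's theorem gives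
  each component its own barrier vertex, and induction matches every component with one vertex
  removed.\<close>

theorem tutte_matching:
  fixes W :: "'v::finite set"
  assumes "tutte_condition E W"
  shows "\<exists>M. matching_on E W M"
  using assms
proof (induction "card W" arbitrary: W rule: less_induct)
  case less
  note tutte = less.prems
  show ?case
  proof (cases "W = {}")
    case True
    then show ?thesis by (intro exI[of _ "{}"]) (simp add: matching_on_def)
  next
    case False
    have "odd_family E W {} {}" by (simp add: odd_family_def detached_family_def)
    then obtain S P where SP: "odd_family E W S P" "card P = card S"
      and max: "\<And>S' P'. odd_family E W S' P' \<Longrightarrow> S \<subseteq> S' \<Longrightarrow> card P' = card S' \<Longrightarrow> card S' \<le> card S"
      using maximal_barrier_exists[of E W "{}" "{}"] by (metis card.empty)
    have cover: "S \<union> \<Union>P = W"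
      by (rule maximal_barrier_cover[OF tutte_condition_even[OF tutte] SP]) (rule max)
    have "S \<noteq> {}"
    proof
      assume "S = {}"
      then have "P = {}" using SP(2) by simp
      with \<open>S = {}\<close> cover False show False by simp
    qed
    have disj: "pairwise disjnt P" "S \<inter> \<Union>P = {}"
      using SP(1) by (auto simp: odd_family_def detached_family_def detached_def)
    have sub: "\<exists>M. matching_on E (C - {c}) M" if "C \<in> P" "c \<in> C" for C c
    proof (rule less.hyps)
      have "C \<subseteq> W" using cover that by blast
      then show "card (C - {c}) < card W" using that by (intro psubset_card_mono) auto
      show "tutte_condition E (C - {c})"
        by (rule maximal_barrier_factor_critical[OF tutte SP _ that]) (rule max)
    qed
    let ?N = "\<lambda>C. {s \<in> S. \<exists>c\<in>C. {s, c} \<in> E}"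
    have "\<exists>f. inj_on f P \<and> (\<forall>C\<in>P. f C \<in> ?N C)"
    proof (rule hall_marriage)
      fix Q assume "Q \<subseteq> P"
      then show "card Q \<le> card (\<Union>(?N ` Q))"
        using tutte odd_family_neighbours[OF SP(1)] by (simp add: tutte_condition_def)
    qed auto
    then obtain f where f: "inj_on f P" "\<And>C. C \<in> P \<Longrightarrow> f C \<in> ?N C" by blast
    have "f ` P = S" using f SP(2) by (intro card_subset_eq) (auto simp: card_image)
    then have "bij_betw f P S" using f by (simp add: bij_betw_def)
    then have "\<exists>M. matching_on E (S \<union> \<Union>P) M"
    proof (rule matching_on_assemble[OF disj])
      fix C assume "C \<in> P"
      then obtain c where "c \<in> C" "{f C, c} \<in> E" using f(2) by blast
      then show "\<exists>c M. c \<in> C \<and> {f C, c} \<in> E \<and> matching_on E (C - {c}) M"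
        using sub[OF \<open>C \<in> P\<close>] by blast
    qed
    then show ?thesis using cover by simp
  qed
qed

section \<open>Elementary graphs\<close>

text \<open>If no perfect matching crosses the cut \<open>A\<close>, enlarge a barrier containing both ends of a
  crossing edge. Every edge from it to a component \<open>C\<close> lies in a perfect matching, so \<open>C\<close>
  is attached only to the side of the cut determined by the parity of \<open>C \<inter> A\<close>; by toughness each
  side of the barrier then has fewer components than vertices.\<close>

lemma tough_crossing_matching:
  fixes E :: "'v::finite set set"
  assumes simple: "simple_graph E" and even: "even CARD('v)"
    and tough: "\<And>S P. detached_family E (- S) P \<Longrightarrow> card P \<le> max 1 (card S)"
    and A: "A \<noteq> {}" "A \<noteq> UNIV"
  shows "\<exists>M x y. matching_on E UNIV M \<and> {x, y} \<in> M \<and> x \<in> A \<and> y \<notin> A"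
proof (rule ccontr)
  assume neg: "\<not> ?thesis"
  \<comment> \<open>Toughness with nothing deleted allows only one component: the graph is
    connected.\<close>
  have conn: "X = {} \<or> X = UNIV" if X: "detached E UNIV X" for X
  proof (rule ccontr)
    assume nontriv: "\<not> (X = {} \<or> X = UNIV)"
    have "detached_family E (- {}) {X}"
      using X nontriv by (auto simp: detached_family_def)
    then have "detached_family E (- {}) (insert (- X) {X})"
      using detached_family_insert_rest[of E "- {}" "{X}"] nontriv by (auto simp: Compl_eq_Diff_UNIV)
    then have "card (insert (- X) {X}) \<le> 1" using tough by fastforce
    moreover have "- X \<noteq> X" using nontriv by blast
    ultimately show False by simp
  qed
  \<comment> \<open>Toughness still permits one component when \<open>S\<close> is empty; by
    connectivity that is the whole graph, which is not odd.\<close>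
  have tutte: "tutte_condition E UNIV"
    unfolding tutte_condition_def
  proof (intro allI impI)
    fix S P assume SP: "odd_family E UNIV S P"
    then have fam: "detached_family E (- S) P" by (simp add: odd_family_def Compl_eq_Diff_UNIV)
    show "card P \<le> card S"
    proof (cases "S = {}")
      case True
      have "P = {}"
      proof (rule ccontr)
        assume "P \<noteq> {}"
        then obtain C where "C \<in> P" by blast
        then have "detached E UNIV C" "odd (card C)"
          using SP True by (auto simp: odd_family_def detached_family_def)
        then show False using conn[of C] even by auto
      qed
      then show ?thesis by simp
    next
      case False
      then have "card S \<ge> 1" by (simp add: Suc_le_eq card_gt_0_iff)
      then show ?thesis using tough[OF fam] by simp
    qed
  qed
  have "\<not> detached E UNIV A" using conn A by blast
  then obtain u v where uv: "u \<in> A" "v \<notin> A" "{u, v} \<in> E" by (auto simp: detached_def)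
  then have "u \<noteq> v" by blast
  let ?W = "- {u, v}"
  \<comment> \<open>A perfect matching of the rest would be completed by the crossing edge
    \<open>{u, v}\<close>.\<close>
  have "\<not> tutte_condition E ?W"
  proof
    assume "tutte_condition E ?W"
    then obtain M where "matching_on E ?W M" using tutte_matching by blast
    then have "matching_on E ({u, v} \<union> ?W) ({{u, v}} \<union> M)"
      by (intro matching_on_Un matching_on_edge uv) auto
    then show False using neg uv by (metis Compl_partition UnI1 singletonI)
  qed
  then obtain S1 P1 where "odd_family E ?W S1 P1" "card S1 < card P1"
    by (auto simp: tutte_condition_def not_le)
  moreover have "even (card ?W)"
    using even \<open>u \<noteq> v\<close> by (simp add: Compl_eq_Diff_UNIV card_Diff_subset)
  ultimately obtain P0 where P0: "odd_family E ?W S1 P0" "card S1 + 2 \<le> card P0"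
    using odd_family_excess by blast
  \<comment> \<open>Adding \<open>u\<close> and \<open>v\<close> uses up the excess of two, so
    \<open>?S0\<close> is a barrier of the whole graph with vertices on both sides of the
    cut.\<close>
  let ?S0 = "{u, v} \<union> S1"
  have "?W - S1 = UNIV - ?S0" by blast
  then have fam0: "odd_family E UNIV ?S0 P0" using P0(1) unfolding odd_family_def by (metis subset_UNIV)
  have "{u, v} \<inter> S1 = {}" using P0(1) by (auto simp: odd_family_def)
  then have "card ?S0 = card {u, v} + card S1" by (metis card_Un_disjoint finite)
  then have "card ?S0 = card S1 + 2" using \<open>u \<noteq> v\<close> by simp
  moreover have "card P0 \<le> card ?S0" using tutte fam0 unfolding tutte_condition_def by blast
  ultimately have "card P0 = card ?S0" using P0(2) by linarith
  then obtain S P where uvS: "?S0 \<subseteq> S" and SP: "odd_family E UNIV S P" "card P = card S"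
    and max: "\<And>S' P'. odd_family E UNIV S' P' \<Longrightarrow> S \<subseteq> S' \<Longrightarrow> card P' = card S' \<Longrightarrow> card S' \<le> card S"
    using maximal_barrier_exists[OF fam0] by metis
  have cover: "S \<union> \<Union>P = UNIV"
    by (rule maximal_barrier_cover[OF tutte_condition_even[OF tutte] SP]) (rule max)
  have disj: "pairwise disjnt P" "S \<inter> \<Union>P = {}" and det: "\<And>C. C \<in> P \<Longrightarrow> detached E (- S) C"
    and odd: "\<And>C. C \<in> P \<Longrightarrow> odd (card C)" and ne: "{} \<notin> P"
    using SP(1) by (auto simp: odd_family_def detached_family_def detached_def)
  let ?N = "\<lambda>C. {s \<in> S. \<exists>c\<in>C. {s, c} \<in> E}"
  \<comment> \<open>The omitted component \<open>C\<close> survives the deletion of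
    \<open>?T\<close>, so the leftover counts as one more member.\<close>
  have surplus: "card Q < card (\<Union>(?N ` Q))" if Q: "Q \<subseteq> P - {C}" "Q \<noteq> {}" "C \<in> P" for Q C
  proof -
    let ?T = "\<Union>(?N ` Q)"
    have fam: "detached_family E (- ?T) Q"
      using odd_family_neighbours[OF SP(1), of Q] Q by (auto simp: odd_family_def Compl_eq_Diff_UNIV)
    have "C \<noteq> {}" using ne Q by blast
    moreover have "C \<inter> D = {}" if "D \<in> Q" for D
    proof -
      have "D \<in> P" "D \<noteq> C" using Q that by auto
      then show ?thesis using disj(1) Q(3) by (auto simp: pairwise_def disjnt_def)
    qed
    moreover have "C \<inter> ?T = {}" using disj(2) Q(3) by blast
    ultimately have rest: "- ?T - \<Union>Q \<noteq> {}" by blast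
    from tough[OF detached_family_insert_rest[OF fam rest]]
    have "card (insert (- ?T - \<Union>Q) Q) \<le> max 1 (card ?T)" .
    moreover have "- ?T - \<Union>Q \<notin> Q" using rest by blast
    moreover have "card Q \<ge> 1" using Q by (simp add: Suc_le_eq card_gt_0_iff)
    ultimately show ?thesis by simp
  qed
  have factor: "\<exists>M. matching_on E (C - {c}) M" if "C \<in> P" "c \<in> C" for C c
    by (rule tutte_matching, rule maximal_barrier_factor_critical[OF tutte SP _ that]) (rule max)
  \<comment> \<open>The edge \<open>{s, c}\<close> extends to a perfect matching: the surplus lets
    the other components be assigned to \<open>S - {s}\<close>, and each component is matched
    internally once its attachment vertex is removed. No edge of this matching crosses the cut, so
    \<open>C - {c}\<close> meets \<open>A\<close> evenly and \<open>c\<close> lies on the side of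
    \<open>s\<close>.\<close>
  have sides: "s \<in> A \<longleftrightarrow> odd (card (C \<inter> A))"
    if C: "C \<in> P" "c \<in> C" and s: "s \<in> S" "{s, c} \<in> E" for C c s
  proof -
    have "\<exists>f. inj_on f (P - {C}) \<and> (\<forall>D\<in>P - {C}. f D \<in> ?N D - {s})"
    proof (rule hall_marriage)
      fix Q assume Q: "Q \<subseteq> P - {C}"
      show "card Q \<le> card (\<Union>D\<in>Q. ?N D - {s})"
      proof (cases "Q = {}")
        case False
        have eq: "(\<Union>D\<in>Q. ?N D - {s}) = \<Union>(?N ` Q) - {s}" by blast
        have "card T \<le> Suc (card (T - {s}))" for T :: "'v set"
          by (auto simp: card_Diff_singleton_if)
        from order.strict_trans2[OF surplus[OF Q False C(1)] this]
        show ?thesis unfolding eq by (rule less_Suc_eq_le[THEN iffD1])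
      qed simp
    qed auto
    then obtain f where f: "inj_on f (P - {C})" "\<And>D. D \<in> P - {C} \<Longrightarrow> f D \<in> ?N D - {s}" by blast
    have "f ` (P - {C}) = S - {s}"
      using f SP(2) C(1) s(1) by (intro card_subset_eq) (auto simp: card_image card_Diff_singleton)
    then have "bij_betw f (P - {C}) (S - {s})" using f by (simp add: bij_betw_def)
    then have "\<exists>M. matching_on E ((S - {s}) \<union> \<Union>(P - {C})) M"
    proof (rule matching_on_assemble[rotated 2])
      show "pairwise disjnt (P - {C})" using disj(1) by (rule pairwise_subset) blast
      show "(S - {s}) \<inter> \<Union>(P - {C}) = {}" using disj(2) by blast
      fix D assume D: "D \<in> P - {C}"
      then obtain d where "d \<in> D" "{f D, d} \<in> E" using f(2) by blast
      then show "\<exists>c M. c \<in> D \<and> {f D, c} \<in> E \<and> matching_on E (D - {c}) M"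
        using factor[of D d] D by blast
    qed
    then obtain M1 where M1: "matching_on E ((S - {s}) \<union> \<Union>(P - {C})) M1" by blast
    obtain M2 where M2: "matching_on E (C - {c}) M2" using factor[OF C] by blast
    have CS: "C \<inter> S = {}" "C \<inter> \<Union>(P - {C}) = {}"
      using disj C(1) by (auto simp: pairwise_def disjnt_def)
    let ?V = "(S - {s}) \<union> \<Union>(P - {C})"
    have sC: "matching_on E ({s, c} \<union> (C - {c})) ({{s, c}} \<union> M2)"
      using CS s(1) by (intro matching_on_Un matching_on_edge M2 s(2)) auto
    have sCV: "({s, c} \<union> (C - {c})) \<inter> ?V = {}" using CS C s(1) disj(2) by blast
    have "({s, c} \<union> (C - {c})) \<union> ?V = UNIV" using cover C s(1) by blast
    then have M: "matching_on E UNIV (({{s, c}} \<union> M2) \<union> M1)"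
      using matching_on_Un[OF sC M1 sCV] by (simp only:)
    have nocross: "x \<in> A \<longleftrightarrow> y \<in> A" if "{x, y} \<in> ({{s, c}} \<union> M2) \<union> M1" for x y
      using neg M that by (metis insert_commute)
    have "even (card ((C - {c}) \<inter> A))"
      using nocross by (intro even_card_matched_Int[OF simple M2]) blast
    moreover have "s \<in> A \<longleftrightarrow> c \<in> A" using nocross[of s c] by blast
    moreover have "(C - {c}) \<inter> A = (C \<inter> A) - {c}" by blast
    ultimately show ?thesis
      using C(2) card_Suc_Diff1[of "C \<inter> A" c] by (cases "c \<in> A") (auto simp flip: even_Suc)
  qed
  define SA where "SA b = {s \<in> S. (s \<in> A) = b}" for b
  define PA where "PA b = {C \<in> P. odd (card (C \<inter> A)) = b}" for b
  \<comment> \<open>By \<open>sides\<close> the components in \<open>PA b\<close> are attached only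
    to \<open>SA b\<close>. Deleting \<open>SA b\<close> also leaves over the other side of the
    barrier, which contains \<open>u\<close> or \<open>v\<close>, so toughness is strict.\<close>
  have less: "card (PA b) < card (SA b)" for b
  proof -
    have "detached E (- SA b) C" if C: "C \<in> PA b" for C
    proof -
      have "C \<in> P" and b: "odd (card (C \<inter> A)) = b" using C by (auto simp: PA_def)
      have "{x, y} \<notin> E" if xy: "x \<in> C" "y \<in> - SA b - C" for x y
      proof
        assume e: "{x, y} \<in> E"
        then have "y \<in> S" using det[OF \<open>C \<in> P\<close>] xy by (auto simp: detached_def)
        then have "(y \<in> A) = b" using sides[OF \<open>C \<in> P\<close> xy(1)] e b by (simp add: insert_commute)
        then show False using \<open>y \<in> S\<close> xy(2) by (simp add: SA_def)
      qed
      moreover have "C \<subseteq> - SA b" using det[OF \<open>C \<in> P\<close>] by (auto simp: detached_def SA_def)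
      ultimately show ?thesis by (simp add: detached_def)
    qed
    then have fam: "detached_family E (- SA b) (PA b)"
      using disj(1) ne by (auto simp: detached_family_def PA_def intro: pairwise_subset)
    have in_SA: "(if b then u else v) \<in> SA b" "(if b then v else u) \<in> SA (\<not> b)"
      using uv uvS by (auto simp: SA_def)
    have "SA (\<not> b) \<subseteq> - SA b - \<Union>(PA b)" using disj(2) by (auto simp: SA_def PA_def)
    then have rest: "- SA b - \<Union>(PA b) \<noteq> {}" using in_SA(2) by blast
    have "card (insert (- SA b - \<Union>(PA b)) (PA b)) \<le> max 1 (card (SA b))"
      by (rule tough[OF detached_family_insert_rest[OF fam rest]])
    moreover have "- SA b - \<Union>(PA b) \<notin> PA b" using rest by blast
    moreover have "card (SA b) \<ge> 1" using in_SA(1) by (auto simp: Suc_le_eq card_gt_0_iff)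
    ultimately show ?thesis by simp
  qed
  have "SA True \<union> SA False = S" "PA True \<union> PA False = P" by (auto simp: SA_def PA_def)
  moreover have "SA True \<inter> SA False = {}" "PA True \<inter> PA False = {}" by (auto simp: SA_def PA_def)
  ultimately have "card S = card (SA True) + card (SA False)" "card P = card (PA True) + card (PA False)"
    by (metis card_Un_disjoint finite)+
  \<comment> \<open>Adding the two strict inequalities contradicts
    \<open>card P = card S\<close>.\<close>
  then show False using less[of True] less[of False] SP(2) by simp
qed

text \<open>Apply the hypothesis to the set of vertices reachable from \<open>s\<close> along edges
  of perfect matchings: such an edge leaving the set would enlarge it. A perfect matching exists
  because a singleton is a proper cut.\<close>

lemma elementary_if_crossing:
  fixes E :: "'v::finite set set"
  assumes card: "CARD('v) > 1"
    and cross: "\<And>A. A \<noteq> {} \<Longrightarrow> A \<noteq> UNIV \<Longrightarrow>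
      \<exists>M x y. matching_on E UNIV M \<and> {x, y} \<in> M \<and> x \<in> A \<and> y \<notin> A"
  shows "elementary E"
proof -
  define F where "F = {e \<in> E. \<exists>M. perfect_matching E M \<and> e \<in> M}"
  fix a :: 'v
  have "{a} \<noteq> UNIV" using card by (metis card.empty card_insert_disjoint empty_iff finite.emptyI less_irrefl One_nat_def)
  then obtain M where M: "perfect_matching E M"
    using cross[of "{a}"] by (auto simp: perfect_matching_iff)
  then have "M \<subseteq> E" "\<Union>M = UNIV" by (auto simp: perfect_matching_def)
  then have "M \<subseteq> F" using M unfolding F_def by blast
  then have "\<Union>F = UNIV" using \<open>\<Union>M = UNIV\<close> by blast
  moreover have "(s, t) \<in> {(x, y). {x, y} \<in> F}\<^sup>*" for s t
  proof -
    let ?A = "{t. (s, t) \<in> {(x, y). {x, y} \<in> F}\<^sup>*}"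
    have "?A = UNIV"
    proof (rule ccontr)
      assume "?A \<noteq> UNIV"
      moreover have "s \<in> ?A" by simp
      ultimately obtain M x y where M: "matching_on E UNIV M" "{x, y} \<in> M" "x \<in> ?A" "y \<notin> ?A"
        using cross[of ?A] by blast
      then have "{x, y} \<in> F" by (auto simp: F_def perfect_matching_iff matching_on_def)
      then have "y \<in> ?A" using M(3) by (auto intro: rtrancl_into_rtrancl)
      with M(4) show False by blast
    qed
    then show ?thesis by blast
  qed
  ultimately show ?thesis
    using M unfolding elementary_def edge_induced_connected_def F_def by auto
qed

theorem theorem5:
  fixes E :: "'v::finite set set" and n :: nat
  assumes "simple_graph E"
    and "E \<noteq> {}"
    and "n = CARD('v)"
    and "even n"
    and "2 * laplacian_eigenvalue E 2 \<ge> laplacian_eigenvalue E n"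
  shows "elementary E"
proof (rule elementary_if_crossing)
  \<comment> \<open>A positive even number of vertices is at least 2.\<close>
  show "CARD('v) > 1"
    using \<open>n = CARD('v)\<close> \<open>even n\<close> by (metis One_nat_def Suc_lessI odd_one zero_less_card_finite)
  fix A :: "'v set"
  assume "A \<noteq> {}" "A \<noteq> UNIV"
  then show "\<exists>M x y. matching_on E UNIV M \<and> {x, y} \<in> M \<and> x \<in> A \<and> y \<notin> A"
  proof (rule tough_crossing_matching[rotated 3])
    show "card P \<le> max 1 (card S)" if "detached_family E (- S) P" for S P
      using assms that by (intro laplacian_tough) auto
  qed (use assms in auto)
qed

end
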